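(* Let $f:\mathcal{H}\to\mathbb{R}$ be $L$-smooth, convex, and $\mu$-gradient dominated. Run the Boosted Frank-Wolfe algorithm (BoostFW) on $\min_{x\in\mathcal{C}}f(x)$ with $\gamma_t\leftarrow\min\{\eta_t\|\nabla f(x_t)\|/(L\|g_t\|),1\}$ or $\gamma_t\leftarrow\arg\min_{\gamma\in[0,1]}f(x_t+\gamma g_t)$, where $\eta_t:=\operatorname{align}(-\nabla f(x_t),g_t)$, and with the following adjustment: whenever $\gamma_t=1$, the update $x_{t+1}=x_t+\gamma_tg_t$ is replaced by $x_{t+1}=x_t+\gamma_t'(v_t-x_t)$, where $v_t\in\arg\min_{v\in\mathcal{V}}\langle\nabla f(x_t),v\rangle$ is the point $v_{k}$ computed in round $k=0$ of iteration $t$ and $\gamma_t'\leftarrow\min\{\langle\nabla f(x_t),x_t-v_t\rangle/(L\|x_t-v_t\|^2),1\}$ or $\gamma_t'\leftarrow\arg\min_{\gamma\in[0,1]}f(x_t+\gamma(v_t-x_t))$. Then for all $t\in\{0,\ldots,T\}$, $$f(x_t)-\min_{\mathcal{C}}f\leq\frac{4LD^2}{t+2}.$$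
   Context: $(\mathcal{H},\langle\cdot,\cdot\rangle)$ is a Euclidean space with induced norm $\|\cdot\|$, and $\mathcal{C}\subset\mathcal{H}$ is a nonempty compact convex set with diameter $D:=\max_{x,y\in\mathcal{C}}\|y-x\|$. If $\mathcal{C}$ is a polytope, $\mathcal{V}$ is its set of vertices; otherwise $\mathcal{V}:=\partial\mathcal{C}$ (the boundary). A differentiable $f:\mathcal{H}\to\mathbb{R}$ is $L$-smooth ($L>0$) if $f(y)-f(x)-\langle\nabla f(x),y-x\rangle\leq\frac{L}{2}\|y-x\|^2$ for all $x,y\in\mathcal{H}$; it is $\mu$-gradient dominated ($\mu>0$) if $\arg\min_{\mathcal{H}}f\neq\varnothing$ and $f(x)-\min_{\mathcal{H}}f\leq\|\nabla f(x)\|^2/(2\mu)$ for all $x\in\mathcal{H}$. For $d\in\mathcal{H}\setminus\{0\}$ and $\hat d\in\mathcal{H}$, $\operatorname{align}(d,\hat d):=\langle d,\hat d\rangle/(\|d\|\|\hat d\|)$ if $\hat d\neq0$, and $\operatorname{align}(d,\hat d):=-1$ if $\hat d=0$. BoostFW. Input: a point $y\in\mathcal{C}$, a maximum number of rounds $K\in\mathbb{N}\setminus\{0\}$, a tolerance $\delta\in(0,1)$, a number of iterations $T$, and a step-size strategy $\gamma_t\in[0,1]$. Set $x_0\in\arg\min_{v\in\mathcal{V}}\langle\nabla f(y),v\rangle$. For $t=0,\ldots,T-1$: (1) Set $d_0=0$, $\Lambda_t=0$. (2) For $k=0,1,\ldots,K-1$: let $r_k=-\nabla f(x_t)-d_k$;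 choose $v_k\in\arg\max_{v\in\mathcal{V}}\langle r_k,v\rangle$; choose $u_k\in\arg\max\{\langle r_k,u\rangle: u\in\{v_k-x_t,\,-d_k/\|d_k\|\}\}$ (with $u_k=v_k-x_t$ when $d_k=0$); let $\lambda_k=\langle r_k,u_k\rangle/\|u_k\|^2$ (with $\lambda_k=0$ if $u_k=0$) and $d_k'=d_k+\lambda_ku_k$. If $\operatorname{align}(-\nabla f(x_t),d_k')-\operatorname{align}(-\nabla f(x_t),d_k)\geq\delta$, then set $d_{k+1}=d_k'$ and update $\Lambda_t\leftarrow\Lambda_t+\lambda_k$ if $u_k=v_k-x_t$, or $\Lambda_t\leftarrow\Lambda_t(1-\lambda_k/\|d_k\|)$ if $u_k=-d_k/\|d_k\|$. Otherwise exit the loop over $k$. (3) Let $K_t$ be the value of $k$ at which the loop was exited early, or $K_t=K$ if it was not exited early. Set $g_t=d_{K_t}/\Lambda_t$ and $x_{t+1}=x_t+\gamma_tg_t$ (this last update being modified as described in the claim when $\gamma_t=1$). (The quantities $d_k,r_k,v_k,u_k,\lambda_k$ depend on $t$. Ties in argmin/argmax are broken arbitrarily.) It is understood that no $x_t$ with $t\leq T-1$ is a minimizer of $f$ over $\mathcal{C}$, so that all steps are well defined. *)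

theory Defs
  imports "HOL-Analysis.Analysis"
begin

definition grad :: "('a::real_inner \<Rightarrow> real) \<Rightarrow> 'a \<Rightarrow> 'a" where
  "grad f x = (THE D. GDERIV f x :> D)"

lemma grad_eqI: "GDERIV f x :> D \<Longrightarrow> grad f x = D"
  unfolding grad_def
proof (rule the_equality)
  fix E assume "GDERIV f x :> D" "GDERIV f x :> E"
  then have "(\<lambda>h. h \<bullet> E) = (\<lambda>h. h \<bullet> D)"
    unfolding gderiv_def by (intro has_derivative_unique)
  then have "\<forall>h. h \<bullet> E = h \<bullet> D"
    by (intro allI, rule fun_cong)
  then show "E = D"
    by (rule vector_eq_ldot[THEN iffD1])
qed

lemma GDERIV_grad:
  fixes f :: "'a::euclidean_space \<Rightarrow> real"
  assumes "f differentiable (at x)"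
  shows "GDERIV f x :> grad f x"
proof -
  obtain F where F: "(f has_derivative F) (at x)"
    using assms unfolding differentiable_def by blast
  then have "linear F"
    by (rule has_derivative_linear)
  have "F = (\<lambda>h. h \<bullet> adjoint F 1)"
    using adjoint_works[OF \<open>linear F\<close>, of _ 1] by (intro ext) simp
  with F have "GDERIV f x :> adjoint F 1"
    by (simp add: gderiv_def)
  then show ?thesis
    by (simp add: grad_eqI)
qed

definition L_smooth :: "real \<Rightarrow> ('a::euclidean_space \<Rightarrow> real) \<Rightarrow> bool" where
  "L_smooth L f \<longleftrightarrow> L > 0 \<and> (\<forall>x. f differentiable (at x)) \<and>
     (\<forall>x y. f y - f x - grad f x \<bullet> (y - x) \<le> L / 2 * (norm (y - x))\<^sup>2)"

definition gradient_dominated :: "real \<Rightarrow> ('a::euclidean_space \<Rightarrow> real) \<Rightarrow> bool" where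
  "gradient_dominated \<mu> f \<longleftrightarrow> \<mu> > 0 \<and> (\<forall>x. f differentiable (at x)) \<and>
     (\<exists>z. is_arg_min f (\<lambda>z. z \<in> UNIV) z) \<and>
     (\<forall>x. f x - (INF z. f z) \<le> (norm (grad f x))\<^sup>2 / (2 * \<mu>))"

text \<open>The set over which the linear subproblems are solved. The boundary is the topological one
  in the ambient space, so it is all of \<open>C\<close> when \<open>C\<close> has empty interior.\<close>

definition oracle_points :: "'a::euclidean_space set \<Rightarrow> 'a set" where
  "oracle_points C = (if polytope C then {v. v extreme_point_of C} else frontier C)"

definition align :: "'a::real_inner \<Rightarrow> 'a \<Rightarrow> real" where
  "align d e = (if e = 0 then - 1 else d \<bullet> e / (norm d * norm e))"

text \<open>One round from the current direction \<open>d\<close> at the iterate \<open>x\<close>, with gradient \<open>G\<close>: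
  \<open>v\<close> and \<open>u\<close> are admissible choices, with ties broken arbitrarily.\<close>

definition boost_choice :: "'a::real_inner set \<Rightarrow> 'a \<Rightarrow> 'a \<Rightarrow> 'a \<Rightarrow> 'a \<Rightarrow> 'a \<Rightarrow> bool" where
  "boost_choice V G x d v u \<longleftrightarrow>
     (let r = - G - d in
        is_arg_max (\<lambda>w. r \<bullet> w) (\<lambda>w. w \<in> V) v \<and>
        (if d = 0 then u = v - x
         else is_arg_max (\<lambda>w. r \<bullet> w) (\<lambda>w. w \<in> {v - x, - (d /\<^sub>R norm d)}) u))"

definition boost_coeff :: "'a::real_inner \<Rightarrow> 'a \<Rightarrow> 'a \<Rightarrow> real" where
  "boost_coeff G d u = (if u = 0 then 0 else (- G - d) \<bullet> u / (norm u)\<^sup>2)"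

definition boost_dir :: "'a::real_inner \<Rightarrow> 'a \<Rightarrow> 'a \<Rightarrow> 'a" where
  "boost_dir G d u = d + boost_coeff G d u *\<^sub>R u"

definition boost_accept :: "real \<Rightarrow> 'a::real_inner \<Rightarrow> 'a \<Rightarrow> 'a \<Rightarrow> bool" where
  "boost_accept \<delta> G d u \<longleftrightarrow> align (- G) (boost_dir G d u) - align (- G) d \<ge> \<delta>"

text \<open>The inner loop at the iterate \<open>x\<close>, with gradient \<open>G\<close>. Here \<open>\<Lambda> k\<close> is the value of the weight
  at the start of round \<open>k\<close>, and \<open>n\<close> is the number of accepted rounds: the loop is left early in
  round \<open>n\<close> if \<open>n < K\<close>, and runs through all rounds if \<open>n = K\<close>. Values of the sequences
  beyond the rounds that are executed are irrelevant.\<close>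

definition boost_rounds ::
  "'a::real_inner set \<Rightarrow> 'a \<Rightarrow> 'a \<Rightarrow> nat \<Rightarrow> real \<Rightarrow>
   (nat \<Rightarrow> 'a) \<Rightarrow> (nat \<Rightarrow> real) \<Rightarrow> (nat \<Rightarrow> 'a) \<Rightarrow> (nat \<Rightarrow> 'a) \<Rightarrow> nat \<Rightarrow> bool" where
  "boost_rounds V G x K \<delta> d \<Lambda> v u n \<longleftrightarrow>
     d 0 = 0 \<and> \<Lambda> 0 = 0 \<and> n \<le> K \<and>
     (\<forall>k<K. k \<le> n \<longrightarrow> boost_choice V G x (d k) (v k) (u k)) \<and>
     (\<forall>k<n. boost_accept \<delta> G (d k) (u k) \<and>
        d (Suc k) = boost_dir G (d k) (u k) \<and>
        \<Lambda> (Suc k) =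
          (if u k = v k - x then \<Lambda> k + boost_coeff G (d k) (u k)
           else \<Lambda> k * (1 - boost_coeff G (d k) (u k) / norm (d k)))) \<and>
     (n < K \<longrightarrow> \<not> boost_accept \<delta> G (d n) (u n))"

definition line_search :: "('a::real_vector \<Rightarrow> real) \<Rightarrow> 'a \<Rightarrow> 'a \<Rightarrow> real \<Rightarrow> bool" where
  "line_search f x p s \<longleftrightarrow> is_arg_min (\<lambda>s. f (x + s *\<^sub>R p)) (\<lambda>s. s \<in> {0..1}) s"

text \<open>One iteration from \<open>x\<close> to \<open>x'\<close>, where a unit step along the boosted direction is replaced by
  a Frank-Wolfe step towards the point \<open>v 0\<close> found in the first round.\<close>

definition boostfw_step ::
  "('a::euclidean_space \<Rightarrow> real) \<Rightarrow> 'a set \<Rightarrow> real \<Rightarrow> nat \<Rightarrow> real \<Rightarrow> 'a \<Rightarrow> 'a \<Rightarrow> bool" where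
  "boostfw_step f C L K \<delta> x x' \<longleftrightarrow>
     (\<exists>d \<Lambda> v u n g \<gamma>.
        boost_rounds (oracle_points C) (grad f x) x K \<delta> d \<Lambda> v u n \<and>
        g = d n /\<^sub>R \<Lambda> n \<and>
        (\<gamma> = min (align (- grad f x) g * norm (grad f x) / (L * norm g)) 1 \<or>
         line_search f x g \<gamma>) \<and>
        (if \<gamma> \<noteq> 1 then x' = x + \<gamma> *\<^sub>R g
         else (\<exists>\<gamma>'.
           (\<gamma>' = min (grad f x \<bullet> (x - v 0) / (L * (norm (x - v 0))\<^sup>2)) 1 \<or>
            line_search f x (v 0 - x) \<gamma>') \<and>
           x' = x + \<gamma>' *\<^sub>R (v 0 - x))))"

text \<open>The requirement that no iterate before the last is a minimizer over \<open>C\<close> keeps the divisions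
  in \<open>boostfw_step\<close> meaningful.\<close>

definition boostfw_run ::
  "('a::euclidean_space \<Rightarrow> real) \<Rightarrow> 'a set \<Rightarrow> real \<Rightarrow> nat \<Rightarrow> real \<Rightarrow> nat \<Rightarrow> 'a \<Rightarrow> (nat \<Rightarrow> 'a) \<Rightarrow> bool" where
  "boostfw_run f C L K \<delta> T y x \<longleftrightarrow>
     is_arg_min (\<lambda>v. grad f y \<bullet> v) (\<lambda>v. v \<in> oracle_points C) (x 0) \<and>
     (\<forall>t<T. \<not> is_arg_min f (\<lambda>z. z \<in> C) (x t) \<and> boostfw_step f C L K \<delta> (x t) (x (Suc t)))"

end

theory Submission
  imports Defs
begin

text \<open>Write \<open>h\<close> for the primal gap \<open>f x - Min\<close> of \<open>f\<close> over \<open>C\<close> at an iterate \<open>x\<close>, and \<open>G\<close> for the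
  gradient at \<open>x\<close>. The proof compares one iteration with a Frank--Wolfe step towards the point
  \<open>v\<^sub>0\<close> found in the first round.

  By convexity, the Frank--Wolfe gap \<open>-G \<bullet> (v\<^sub>0 - x)\<close> is at least \<open>h\<close>, provided that \<open>v\<^sub>0\<close> maximizes
  \<open>-G\<close> over all of \<open>C\<close> and not just over the oracle points (\<open>oracle_point_maximizes\<close>).
  For a direction \<open>p\<close>, the best decrease that \<open>L\<close>-smoothness guarantees is
  \<open>(-G \<bullet> p)\<^sup>2 / (2 L \<parallel>p\<parallel>\<^sup>2) = (align (-G) p * \<parallel>G\<parallel>)\<^sup>2 / (2 L)\<close>. It depends on \<open>p\<close> only through its
  alignment with \<open>-G\<close>, and it is achieved by both step-size rules unless they return the
  step size 1 (\<open>step_size_decrease\<close>).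
  The first boosting round gives the direction \<open>v\<^sub>0 - x\<close> up to a positive factor, and it is always
  accepted. Each later accepted round increases the alignment, so the boosted direction \<open>g\<close> is at
  least as well aligned as \<open>v\<^sub>0 - x\<close>. It also satisfies \<open>x + g \<in> C\<close> (\<open>boosted_direction\<close>).
  Hence a boosted step of size less than 1 gains at least \<open>h\<^sup>2 / (2 L D\<^sup>2)\<close>. The boosted step of
  size 1 has no such guarantee, which is why it is replaced by a Frank--Wolfe step. The latter
  gains \<open>h\<^sup>2 / (2 L D\<^sup>2)\<close> or \<open>h / 2\<close>, whichever is smaller (\<open>boostfw_step_decrease\<close>).

  The choice of the starting point makes the first gap at most \<open>L D\<^sup>2 / 2\<close>. From there on
  \<open>h\<^sup>2 / (2 L D\<^sup>2)\<close> is the smaller of the two gains, and the recurrence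
  \<open>h' \<le> h - h\<^sup>2 / (2 L D\<^sup>2)\<close> keeps \<open>h \<le> 2 L D\<^sup>2 / (t + 4)\<close>, which is slightly stronger
  than the claimed rate.\<close>

section \<open>Linear maximization over the oracle points\<close>

lemma oracle_points_subset:
  assumes "compact C"
  shows "oracle_points C \<subseteq> C"
  using assms frontier_subset_closed[of C]
  by (auto simp: oracle_points_def extreme_point_of_def dest: compact_imp_closed)

text \<open>A polytope is the convex hull of its vertices, so a bound that holds at the vertices holds
  everywhere. In the other case, a maximizer in the interior is possible only for the zero
  functional, which every boundary point maximizes.\<close>

lemma linear_max_attained_on_oracle_points:
  fixes C :: "'a::euclidean_space set"
  assumes "compact C" "convex C" "C \<noteq> {}"
  obtains w where "w \<in> oracle_points C" "\<And>c. c \<in> C \<Longrightarrow> r \<bullet> c \<le> r \<bullet> w"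
proof (cases "polytope C")
  case True
  let ?V = "{v. v extreme_point_of C}"
  have hull: "C = convex hull ?V"
    using Krein_Milman_Minkowski assms by blast
  have fin: "finite ?V"
    using True by (rule finite_polyhedron_extreme_points[OF polytope_imp_polyhedron])
  have ne: "?V \<noteq> {}"
    using hull assms(3) by auto
  obtain w where w: "w \<in> ?V" "\<And>v. v \<in> ?V \<Longrightarrow> r \<bullet> v \<le> r \<bullet> w"
  proof -
    have "Max ((\<bullet>) r ` ?V) \<in> (\<bullet>) r ` ?V"
      using fin ne by (intro Max_in) auto
    then obtain w where "w \<in> ?V" "Max ((\<bullet>) r ` ?V) = r \<bullet> w" by auto
    then show ?thesis
      using fin by (intro that[of w]) (auto intro!: Max_ge simp flip: \<open>Max _ = _\<close>)
  qed
  have "convex hull ?V \<subseteq> {c. r \<bullet> c \<le> r \<bullet> w}"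
    using w(2) by (intro hull_minimal) (auto simp: convex_halfspace_le)
  then show ?thesis
    using that[of w] w(1) hull True by (auto simp: oracle_points_def)
next
  case False
  obtain c where c: "c \<in> C" "\<And>y. y \<in> C \<Longrightarrow> r \<bullet> y \<le> r \<bullet> c"
    using continuous_attains_sup[OF assms(1,3), of "(\<bullet>) r"]
    by (force intro: continuous_on_inner continuous_on_const continuous_on_id)
  show ?thesis
  proof (cases "c \<in> frontier C")
    case True
    then show ?thesis using that[of c] c False by (auto simp: oracle_points_def)
  next
    case inner: False
    then have "c \<in> interior C"
      using c(1) closure_subset by (auto simp: frontier_def)
    then obtain e where e: "e > 0" "cball c e \<subseteq> C"
      by (auto simp: mem_interior_cball)
    have "r = 0"
    proof (rule ccontr)
      assume "r \<noteq> 0"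
      then have "c + (e / norm r) *\<^sub>R r \<in> cball c e"
        using e(1) by (simp add: dist_norm)
      then have "r \<bullet> (c + (e / norm r) *\<^sub>R r) \<le> r \<bullet> c"
        using c(2) e(2) by blast
      then show False
        using \<open>r \<noteq> 0\<close> e(1) by (simp add: inner_add_right zero_less_mult_iff not_le
            flip: not_less)
    qed
    moreover have "frontier C \<noteq> {}"
      using assms frontier_not_empty[of C] compact_imp_bounded by force
    ultimately show ?thesis
      using that False by (auto simp: oracle_points_def)
  qed
qed

lemma oracle_point_maximizes:
  fixes C :: "'a::euclidean_space set"
  assumes "compact C" "convex C"
    and "is_arg_max (\<lambda>w. r \<bullet> w) (\<lambda>w. w \<in> oracle_points C) v" "c \<in> C"
  shows "r \<bullet> c \<le> r \<bullet> v"
proof -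
  obtain w where "w \<in> oracle_points C" "r \<bullet> c \<le> r \<bullet> w"
    using linear_max_attained_on_oracle_points[OF assms(1,2), of r] assms(4) by blast
  with assms(3) show ?thesis
    by (force simp: is_arg_max_linorder)
qed

section \<open>Smooth convex functions and the step-size rules\<close>

lemma L_smooth_along:
  assumes "L_smooth L f"
  shows "f (x + s *\<^sub>R p) \<le> f x + s * (grad f x \<bullet> p) + L / 2 * s\<^sup>2 * (norm p)\<^sup>2"
proof -
  have "f (x + s *\<^sub>R p) - f x - grad f x \<bullet> (x + s *\<^sub>R p - x) \<le> L / 2 * (norm (x + s *\<^sub>R p - x))\<^sup>2"
    using assms unfolding L_smooth_def by blast
  then show ?thesis by (simp add: power_mult_distrib)
qed

lemma convex_on_line:
  assumes "convex_on UNIV f"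
  shows "convex_on UNIV (\<lambda>s::real. f (x + s *\<^sub>R p))"
proof (rule convex_onI)
  fix t a b :: real
  assume "0 < t" "t < 1"
  have "x + ((1 - t) *\<^sub>R a + t *\<^sub>R b) *\<^sub>R p = (1 - t) *\<^sub>R (x + a *\<^sub>R p) + t *\<^sub>R (x + b *\<^sub>R p)"
    by (simp add: algebra_simps)
  with convex_onD[OF assms, of t "x + a *\<^sub>R p" "x + b *\<^sub>R p"] \<open>0 < t\<close> \<open>t < 1\<close>
  show "f (x + ((1 - t) *\<^sub>R a + t *\<^sub>R b) *\<^sub>R p) \<le> (1 - t) * f (x + a *\<^sub>R p) + t * f (x + b *\<^sub>R p)"
    by simp
qed simp

lemma convex_above_tangent:
  fixes f :: "'a::euclidean_space \<Rightarrow> real"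
  assumes "convex_on UNIV f" "f differentiable (at x)"
  shows "f x + grad f x \<bullet> (z - x) \<le> f z"
proof -
  let ?\<phi> = "\<lambda>s::real. f (x + s *\<^sub>R (z - x))"
  have "(f has_derivative (\<lambda>h. h \<bullet> grad f x)) (at (x + 0 *\<^sub>R (z - x)))"
    using GDERIV_grad[OF assms(2)] by (simp add: gderiv_def)
  moreover have "((\<lambda>s::real. x + s *\<^sub>R (z - x)) has_derivative (\<lambda>s. s *\<^sub>R (z - x))) (at 0)"
    by (auto intro!: derivative_eq_intros)
  ultimately have "(?\<phi> has_derivative (\<lambda>s. (s *\<^sub>R (z - x)) \<bullet> grad f x)) (at 0)"
    by (rule has_derivative_compose[rotated])
  then have "(?\<phi> has_field_derivative (z - x) \<bullet> grad f x) (at 0)"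
    by (simp add: has_field_derivative_def mult.commute[of _ "(z - x) \<bullet> grad f x"])
  then have "((z - x) \<bullet> grad f x) * (1 - 0) \<le> ?\<phi> 1 - ?\<phi> 0"
    by (intro convex_on_imp_above_tangent[OF convex_on_line[OF assms(1)]]) auto
  then show ?thesis by (simp add: inner_commute)
qed

text \<open>Line search over the unit interval is as good as line search over the half-line, as long as
  it does not stop at the right end: by convexity, a smaller value beyond 1 would force smaller
  values already inside the interval.\<close>

lemma line_search_global:
  assumes "convex_on UNIV f" "line_search f x p s" "s \<noteq> 1" "0 \<le> t"
  shows "f (x + s *\<^sub>R p) \<le> f (x + t *\<^sub>R p)"
proof -
  have s: "0 \<le> s" "s < 1"
    and opt: "\<And>q. 0 \<le> q \<Longrightarrow> q \<le> 1 \<Longrightarrow> f (x + s *\<^sub>R p) \<le> f (x + q *\<^sub>R p)"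
    using assms(2,3) by (auto simp: line_search_def is_arg_min_linorder)
  show ?thesis
  proof (cases "t \<le> 1")
    case True
    then show ?thesis using opt assms(4) by blast
  next
    case False
    \<comment> \<open>The point 1 divides the segment from \<open>s\<close> to \<open>t\<close> with weight \<open>c\<close> on \<open>t\<close>.\<close>
    define c where "c = (1 - s) / (t - s)"
    have c: "0 < c" "c < 1"
      using s False by (auto simp: c_def field_simps)
    have "(1 - c) *\<^sub>R s + c *\<^sub>R t = s + c * (t - s)"
      by (simp add: algebra_simps)
    also have "\<dots> = 1"
      using s False by (simp add: c_def)
    finally have "f (x + 1 *\<^sub>R p) \<le> (1 - c) * f (x + s *\<^sub>R p) + c * f (x + t *\<^sub>R p)"
      using convex_onD[OF convex_on_line[OF assms(1), of x p], of c s t] c by simp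
    with opt[of 1] have "c * f (x + s *\<^sub>R p) \<le> c * f (x + t *\<^sub>R p)"
      by (simp add: algebra_simps)
    then show ?thesis using c by simp
  qed
qed

text \<open>The quadratic upper bound along \<open>p\<close> is minimized at step size \<open>a / (L \<parallel>p\<parallel>\<^sup>2)\<close>, where its value
  is \<open>f x - a\<^sup>2 / (2 L \<parallel>p\<parallel>\<^sup>2)\<close>. If this step size is cut off at 1, then the quadratic term is at most
  half of the linear one, and \<open>a / 2\<close> of decrease remains.\<close>

lemma step_size_decrease:
  fixes f :: "'a::euclidean_space \<Rightarrow> real"
  assumes "L_smooth L f" "convex_on UNIV f"
    and a: "a = - grad f x \<bullet> p" "a > 0"
    and s: "s = min (a / (L * (norm p)\<^sup>2)) 1 \<or> line_search f x p s"
  shows "0 \<le> s" "s \<le> 1"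
    and "f (x + s *\<^sub>R p) \<le> f x - min (a / 2) (a\<^sup>2 / (2 * L * (norm p)\<^sup>2))"
    and "s \<noteq> 1 \<Longrightarrow> f (x + s *\<^sub>R p) \<le> f x - a\<^sup>2 / (2 * L * (norm p)\<^sup>2)"
proof -
  have L: "L > 0" using assms(1) by (simp add: L_smooth_def)
  have p: "p \<noteq> 0" using a by auto
  define N where "N = L * (norm p)\<^sup>2"
  have N: "N > 0" using L p by (simp add: N_def)
  define m where "m = a / N"
  have m: "m > 0" "a = m * N" using a(2) N by (auto simp: m_def)
  have bound: "f (x + q *\<^sub>R p) \<le> f x - q * a + q\<^sup>2 * N / 2" for q
    using L_smooth_along[OF assms(1), of x q p] a(1) by (simp add: N_def algebra_simps)
  have "a\<^sup>2 / (2 * L * (norm p)\<^sup>2) = (m * N)\<^sup>2 / (2 * N)"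
    by (simp add: m(2) N_def)
  then have val: "a\<^sup>2 / (2 * L * (norm p)\<^sup>2) = m\<^sup>2 * N / 2"
    using N by (simp add: power2_eq_square)
  have full: "f (x + m *\<^sub>R p) \<le> f x - a\<^sup>2 / (2 * L * (norm p)\<^sup>2)"
    using bound[of m] unfolding val by (simp add: m(2) power2_eq_square algebra_simps)
  have cut: "f (x + min m 1 *\<^sub>R p) \<le> f x - min (a / 2) (a\<^sup>2 / (2 * L * (norm p)\<^sup>2))"
  proof (cases "m \<le> 1")
    case True
    then show ?thesis using full by simp
  next
    case False
    then have "N \<le> a" using N by (simp add: m(2))
    then show ?thesis using bound[of 1] False by simp
  qed
  have s': "s = min m 1 \<or> line_search f x p s"
    using s by (simp add: m_def N_def)
  show "0 \<le> s" "s \<le> 1"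
    using s' m(1) by (auto simp: line_search_def is_arg_min_linorder)
  have "f (x + s *\<^sub>R p) \<le> f (x + min m 1 *\<^sub>R p)"
    using s' m(1) by (auto simp: line_search_def is_arg_min_linorder)
  with cut show "f (x + s *\<^sub>R p) \<le> f x - min (a / 2) (a\<^sup>2 / (2 * L * (norm p)\<^sup>2))"
    by linarith
  show "f (x + s *\<^sub>R p) \<le> f x - a\<^sup>2 / (2 * L * (norm p)\<^sup>2)" if "s \<noteq> 1"
    using s'
  proof
    assume "s = min m 1"
    with that have "s = m" by auto
    then show ?thesis using full by simp
  next
    assume "line_search f x p s"
    from line_search_global[OF assms(2) this that, of m] m(1) full show ?thesis by linarith
  qed
qed

section \<open>The boosting rounds\<close>

lemma align_scaleR:
  assumes "c > 0"
  shows "align d (c *\<^sub>R e) = align d e"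
  using assms by (simp add: align_def)

lemma align_pos_iff: "align d e > 0 \<longleftrightarrow> d \<bullet> e > 0"
proof (cases "d = 0 \<or> e = 0")
  case False
  then have "norm d * norm e > 0" by simp
  with False show ?thesis by (simp add: align_def pos_less_divide_eq)
qed (auto simp: align_def)

text \<open>A round along \<open>- d / \<parallel>d\<parallel>\<close> replaces \<open>d\<close> by the projection of \<open>- G\<close> onto the line of \<open>d\<close>, which
  is a positive multiple of \<open>d\<close>. This leaves the alignment unchanged and therefore fails the
  acceptance test.\<close>

lemma backward_direction_rejected:
  assumes "align (- G) d > 0" "\<delta> > 0"
  shows "\<not> boost_accept \<delta> G d (- (d /\<^sub>R norm d))"
proof -
  have pos: "- G \<bullet> d > 0" using assms(1) by (simp add: align_pos_iff)
  then have d: "d \<noteq> 0" by auto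
  define c where "c = (- G \<bullet> d) / (norm d)\<^sup>2"
  have "c > 0" unfolding c_def using pos d by (intro divide_pos_pos) auto
  have "boost_coeff G d (- (d /\<^sub>R norm d)) = norm d * (1 - c)"
    using d by (simp add: boost_coeff_def c_def inner_diff_left field_simps
        dot_square_norm power2_eq_square)
  then have "boost_dir G d (- (d /\<^sub>R norm d)) = d - (1 - c) *\<^sub>R d"
    using d by (simp add: boost_dir_def)
  then have "boost_dir G d (- (d /\<^sub>R norm d)) = c *\<^sub>R d"
    by (simp add: algebra_simps)
  then show ?thesis
    using assms(2) by (simp add: boost_accept_def align_scaleR[OF \<open>c > 0\<close>])
qed

text \<open>Since all accepted rounds add a nonnegative multiple of some \<open>v - x\<close>, the weight \<open>\<Lambda>\<close>
  is the total of the coefficients, and normalizing by it gives a direction that ends in \<open>C\<close>.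
  Alignments never decrease from \<open>align (- G) (v 0 - x)\<close>, the value after the first round.\<close>

lemma boosted_direction:
  fixes C :: "'a::euclidean_space set"
  assumes "compact C" "convex C" "x \<in> C" "K > 0" "0 < \<delta>" "\<delta> < 1"
    and rounds: "boost_rounds (oracle_points C) G x K \<delta> d \<Lambda> v u n"
    and first: "- G \<bullet> (v 0 - x) > 0"
  defines "g \<equiv> d n /\<^sub>R \<Lambda> n"
  shows "x + g \<in> C" and "align (- G) (v 0 - x) \<le> align (- G) g"
proof -
  have d0: "d 0 = 0" and \<Lambda>0: "\<Lambda> 0 = 0" and "n \<le> K"
    and choice: "\<And>k. k < K \<Longrightarrow> k \<le> n \<Longrightarrow> boost_choice (oracle_points C) G x (d k) (v k) (u k)"
    and acc: "\<And>k. k < n \<Longrightarrow> boost_accept \<delta> G (d k) (u k)"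
    and dS: "\<And>k. k < n \<Longrightarrow> d (Suc k) = boost_dir G (d k) (u k)"
    and \<Lambda>S: "\<And>k. k < n \<Longrightarrow> \<Lambda> (Suc k) =
          (if u k = v k - x then \<Lambda> k + boost_coeff G (d k) (u k)
           else \<Lambda> k * (1 - boost_coeff G (d k) (u k) / norm (d k)))"
    and stop: "n < K \<Longrightarrow> \<not> boost_accept \<delta> G (d n) (u n)"
    using rounds unfolding boost_rounds_def by auto
  have v_in: "v k \<in> C" and coeff: "boost_coeff G (d k) (v k - x) \<ge> 0" if "k < K" "k \<le> n" for k
  proof -
    have max: "is_arg_max (\<lambda>w. (- G - d k) \<bullet> w) (\<lambda>w. w \<in> oracle_points C) (v k)"
      using choice[OF that] by (auto simp: boost_choice_def Let_def)
    then show "v k \<in> C"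
      using oracle_points_subset[OF assms(1)] by (auto simp: is_arg_max_def)
    show "boost_coeff G (d k) (v k - x) \<ge> 0"
      using oracle_point_maximizes[OF assms(1,2) max assms(3)]
      by (simp add: boost_coeff_def inner_diff_right)
  qed
  define c0 where "c0 = boost_coeff G 0 (v 0 - x)"
  have "v 0 \<noteq> x" using first by auto
  have c0: "c0 > 0"
    using first \<open>v 0 \<noteq> x\<close> divide_pos_pos[of "- G \<bullet> (v 0 - x)" "(norm (v 0 - x))\<^sup>2"]
    by (simp add: c0_def boost_coeff_def)
  have u0: "u 0 = v 0 - x"
    using choice[of 0] \<open>K > 0\<close> d0 by (simp add: boost_choice_def Let_def)
  have dir0: "boost_dir G (d 0) (u 0) = c0 *\<^sub>R (v 0 - x)"
    by (simp add: boost_dir_def d0 u0 c0_def)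
  have pos0: "align (- G) (v 0 - x) > 0"
    using first by (simp add: align_pos_iff)
  \<comment> \<open>The zero direction has alignment -1 by convention, so the first round raises the alignment by
    more than 1, which exceeds \<open>\<delta>\<close>.\<close>
  have "n \<noteq> 0"
  proof
    assume "n = 0"
    then have "\<not> boost_accept \<delta> G (d 0) (u 0)"
      using stop \<open>K > 0\<close> by simp
    moreover have "align (- G) (d 0) = - 1"
      by (simp add: align_def d0)
    ultimately show False
      using dir0 pos0 \<open>\<delta> < 1\<close> by (simp add: boost_accept_def align_scaleR[OF c0])
  qed
  have "Suc k \<le> n \<Longrightarrow> \<Lambda> (Suc k) > 0 \<and> x + d (Suc k) /\<^sub>R \<Lambda> (Suc k) \<in> C \<and>
      align (- G) (v 0 - x) \<le> align (- G) (d (Suc k))" for k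
  proof (induction k)
    case 0
    have \<Lambda>1: "\<Lambda> (Suc 0) = c0"
      using 0 \<Lambda>S[of 0] by (simp add: u0 \<Lambda>0 d0 c0_def)
    have d1: "d (Suc 0) = c0 *\<^sub>R (v 0 - x)"
      using 0 dS[of 0] dir0 by simp
    show ?case
      unfolding \<Lambda>1 d1 using c0 v_in[of 0] \<open>K > 0\<close> by (simp add: align_scaleR)
  next
    case (Suc k)
    let ?k = "Suc k"
    have lt: "?k < n" "?k < K" using Suc.prems \<open>n \<le> K\<close> by auto
    define c where "c = x + d ?k /\<^sub>R \<Lambda> ?k"
    define l where "l = boost_coeff G (d ?k) (v ?k - x)"
    have IH: "\<Lambda> ?k > 0" "c \<in> C" "align (- G) (v 0 - x) \<le> align (- G) (d ?k)"
      using Suc by (auto simp: c_def)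
    have al: "align (- G) (d ?k) > 0" using IH(3) pos0 by linarith
    have dc: "d ?k = \<Lambda> ?k *\<^sub>R (c - x)" using IH(1) by (simp add: c_def)
    have ne: "d ?k \<noteq> 0" using al by (auto simp: align_def)
    have "u ?k \<noteq> - (d ?k /\<^sub>R norm (d ?k))"
      using backward_direction_rejected[OF al \<open>0 < \<delta>\<close>] acc[OF lt(1)] by metis
    then have u: "u ?k = v ?k - x"
      using choice[of ?k] lt ne by (auto simp: boost_choice_def Let_def is_arg_max_def)
    have l: "l \<ge> 0" using coeff[of ?k] lt by (simp add: l_def)
    have \<Lambda>': "\<Lambda> (Suc ?k) = \<Lambda> ?k + l"
      using \<Lambda>S[OF lt(1)] u by (simp add: l_def)
    have d': "d (Suc ?k) = \<Lambda> ?k *\<^sub>R (c - x) + l *\<^sub>R (v ?k - x)"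
      using dS[OF lt(1)] u dc by (simp add: boost_dir_def l_def)
    have pos: "\<Lambda> ?k + l > 0" using IH(1) l by linarith
    have "x + d (Suc ?k) /\<^sub>R \<Lambda> (Suc ?k) =
        (\<Lambda> ?k / (\<Lambda> ?k + l)) *\<^sub>R c + (l / (\<Lambda> ?k + l)) *\<^sub>R v ?k"
    proof -
      have "(\<Lambda> ?k + l) *\<^sub>R (x + d (Suc ?k) /\<^sub>R \<Lambda> (Suc ?k)) = (\<Lambda> ?k + l) *\<^sub>R x + d (Suc ?k)"
        using pos by (simp add: \<Lambda>' scaleR_add_right)
      also have "\<dots> = \<Lambda> ?k *\<^sub>R c + l *\<^sub>R v ?k"
        by (simp add: d' algebra_simps)
      also have "\<dots> = (\<Lambda> ?k + l) *\<^sub>R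
          ((\<Lambda> ?k / (\<Lambda> ?k + l)) *\<^sub>R c + (l / (\<Lambda> ?k + l)) *\<^sub>R v ?k)"
        using pos by (simp add: scaleR_add_right)
      finally show ?thesis using pos by simp
    qed
    moreover have "\<dots> \<in> C"
      using assms(2) IH(1,2) v_in[of ?k] lt l pos
      by (intro convexD) (auto simp flip: add_divide_distrib)
    moreover have "align (- G) (d ?k) \<le> align (- G) (d (Suc ?k))"
      using acc[OF lt(1)] dS[OF lt(1)] \<open>0 < \<delta>\<close> by (simp add: boost_accept_def)
    ultimately show ?case using \<Lambda>' pos IH(3) by simp
  qed
  from this[of "n - 1"] \<open>n \<noteq> 0\<close>
  have fin: "\<Lambda> n > 0" "x + g \<in> C" "align (- G) (v 0 - x) \<le> align (- G) (d n)"
    by (auto simp: g_def)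
  show "x + g \<in> C" by (rule fin(2))
  show "align (- G) (v 0 - x) \<le> align (- G) g"
    using fin(1,3) by (simp add: g_def align_scaleR)
qed

section \<open>Progress of one iteration\<close>

lemma boostfw_step_decrease:
  fixes f :: "'a::euclidean_space \<Rightarrow> real"
  assumes C: "compact C" "convex C"
    and f: "L_smooth L f" "convex_on UNIV f"
    and par: "K > 0" "0 < \<delta>" "\<delta> < 1"
    and x: "x \<in> C" and z: "z \<in> C" "f z < f x"
    and step: "boostfw_step f C L K \<delta> x x'"
  defines "h \<equiv> f x - f z"
  shows "x' \<in> C" and "f x' \<le> f x - min (h / 2) (h\<^sup>2 / (2 * L * (diameter C)\<^sup>2))"
proof -
  define G where "G = grad f x"
  from step obtain d \<Lambda> v u n g \<gamma> where
    rounds: "boost_rounds (oracle_points C) G x K \<delta> d \<Lambda> v u n"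
    and g: "g = d n /\<^sub>R \<Lambda> n"
    and \<gamma>: "\<gamma> = min (align (- G) g * norm G / (L * norm g)) 1 \<or> line_search f x g \<gamma>"
    and x': "if \<gamma> \<noteq> 1 then x' = x + \<gamma> *\<^sub>R g
         else (\<exists>\<gamma>'.
           (\<gamma>' = min (G \<bullet> (x - v 0) / (L * (norm (x - v 0))\<^sup>2)) 1 \<or>
            line_search f x (v 0 - x) \<gamma>') \<and>
           x' = x + \<gamma>' *\<^sub>R (v 0 - x))"
    unfolding boostfw_step_def G_def by metis
  have L: "L > 0" using f(1) by (simp add: L_smooth_def)
  have h: "h > 0" using z by (simp add: h_def)
  define p where "p = v 0 - x"
  define a where "a = - G \<bullet> p"
  have max0: "is_arg_max (\<lambda>w. - G \<bullet> w) (\<lambda>w. w \<in> oracle_points C) (v 0)"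
  proof -
    have "d 0 = 0" "boost_choice (oracle_points C) G x (d 0) (v 0) (u 0)"
      using rounds par(1) unfolding boost_rounds_def G_def by auto
    then show ?thesis by (simp add: boost_choice_def del: inner_minus_left)
  qed
  have v0: "v 0 \<in> C"
    using max0 oracle_points_subset[OF C(1)] by (auto simp: is_arg_max_def)
  have "h \<le> - G \<bullet> (z - x)"
    using convex_above_tangent[OF f(2), of x z] f(1)
    by (simp add: h_def G_def L_smooth_def)
  also have "\<dots> \<le> a"
    using oracle_point_maximizes[OF C max0 z(1)] by (simp add: a_def p_def inner_diff_right)
  finally have ha: "h \<le> a" .
  then have a: "a > 0" using h by linarith
  have p: "p \<noteq> 0" using a by (auto simp: a_def)
  have xp: "x + p \<in> C" using v0 by (simp add: p_def)
  have G: "G \<noteq> 0" using a by (auto simp: a_def)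
  have pD: "norm p \<le> diameter C"
    using diameter_bounded_bound[OF compact_imp_bounded[OF C(1)] v0 x]
    by (simp add: p_def dist_norm)
  have move: "x + s *\<^sub>R q \<in> C" if "0 \<le> s" "s \<le> 1" "x + q \<in> C" for s q
  proof -
    have "x + s *\<^sub>R q = (1 - s) *\<^sub>R x + s *\<^sub>R (x + q)" by (simp add: algebra_simps)
    then show ?thesis using convexD_alt[OF C(2) x that(3)] that by simp
  qed
  have gain: "h\<^sup>2 / (2 * L * (diameter C)\<^sup>2) \<le> a\<^sup>2 / (2 * L * (norm p)\<^sup>2)"
    using ha h L p pD by (intro frac_le mult_left_mono power_mono) auto
  have xg: "x + g \<in> C" and al: "align (- G) p \<le> align (- G) g"
    using boosted_direction[OF C x par rounds] a unfolding g a_def p_def by auto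
  define b where "b = - G \<bullet> g"
  have "align (- G) p > 0" using a by (simp add: align_pos_iff a_def)
  then have "align (- G) g > 0" using al by linarith
  then have b: "b > 0" by (simp add: align_pos_iff b_def)
  have g0: "g \<noteq> 0" using b by (auto simp: b_def)
  show "x' \<in> C" "f x' \<le> f x - min (h / 2) (h\<^sup>2 / (2 * L * (diameter C)\<^sup>2))"
  proof (atomize (full), cases "\<gamma> = 1")
    case False
    have "align (- G) g * norm G / (L * norm g) = b / (L * (norm g)\<^sup>2)"
      using G g0 by (simp add: align_def b_def power2_eq_square field_simps)
    with \<gamma> have \<gamma>': "\<gamma> = min (b / (L * (norm g)\<^sup>2)) 1 \<or> line_search f x g \<gamma>" by simp
    note dec = step_size_decrease[OF f b_def[unfolded G_def] b \<gamma>']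
    have "a / (norm G * norm p) \<le> b / (norm G * norm g)"
      using al p g0 by (simp add: align_def a_def b_def)
    then have "a / norm p \<le> b / norm g"
      using G by (simp add: divide_le_cancel mult.commute[of "norm G"] flip: divide_divide_eq_left)
    then have "(a / norm p)\<^sup>2 / (2 * L) \<le> (b / norm g)\<^sup>2 / (2 * L)"
      using a L by (intro divide_right_mono power_mono) auto
    then have "a\<^sup>2 / (2 * L * (norm p)\<^sup>2) \<le> b\<^sup>2 / (2 * L * (norm g)\<^sup>2)"
      by (simp add: power_divide mult_ac)
    then show "x' \<in> C \<and> f x' \<le> f x - min (h / 2) (h\<^sup>2 / (2 * L * (diameter C)\<^sup>2))"
      using dec(4)[OF False] gain x' False move[OF dec(1,2) xg] by auto
  next
    case True
    then obtain s where s0: "s = min (G \<bullet> (x - v 0) / (L * (norm (x - v 0))\<^sup>2)) 1 \<or> line_search f x p s"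
      and x's: "x' = x + s *\<^sub>R p"
      using x' by (auto simp: p_def)
    have "G \<bullet> (x - v 0) = a" "norm (x - v 0) = norm p"
      by (simp_all add: a_def p_def inner_diff_right norm_minus_commute)
    with s0 have s: "s = min (a / (L * (norm p)\<^sup>2)) 1 \<or> line_search f x p s" by simp
    note dec = step_size_decrease[OF f a_def[unfolded G_def] a s]
    show "x' \<in> C \<and> f x' \<le> f x - min (h / 2) (h\<^sup>2 / (2 * L * (diameter C)\<^sup>2))"
      using dec(3) gain x's ha move[OF dec(1,2) xp] by auto
  qed
qed

section \<open>The convergence rate\<close>

text \<open>Minimizing the linear part of \<open>f\<close> at \<open>y\<close> makes it at most its value at \<open>z\<close>, which convexity
  bounds by \<open>f z\<close>. The quadratic part costs at most \<open>L D\<^sup>2 / 2\<close>.\<close>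

lemma initial_gap:
  fixes f :: "'a::euclidean_space \<Rightarrow> real"
  assumes C: "compact C" "convex C"
    and f: "L_smooth L f" "convex_on UNIV f"
    and y: "y \<in> C" and z: "z \<in> C"
    and x: "is_arg_min (\<lambda>v. grad f y \<bullet> v) (\<lambda>v. v \<in> oracle_points C) x"
  shows "x \<in> C" and "f x - f z \<le> L * (diameter C)\<^sup>2 / 2"
proof -
  have L: "L > 0" using f(1) by (simp add: L_smooth_def)
  have max: "is_arg_max (\<lambda>v. - grad f y \<bullet> v) (\<lambda>v. v \<in> oracle_points C) x"
    using x by (auto simp: is_arg_min_def is_arg_max_def)
  show xC: "x \<in> C"
    using x oracle_points_subset[OF C(1)] by (auto simp: is_arg_min_def)
  have "f x \<le> f y + grad f y \<bullet> (x - y) + L / 2 * (norm (x - y))\<^sup>2"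
    using L_smooth_along[OF f(1), of y 1 "x - y"] by simp
  moreover have "grad f y \<bullet> (x - y) \<le> grad f y \<bullet> (z - y)"
    using oracle_point_maximizes[OF C max z] by (simp add: inner_diff_right)
  moreover have "f y + grad f y \<bullet> (z - y) \<le> f z"
    using convex_above_tangent[OF f(2), of y z] f(1) by (simp add: L_smooth_def)
  moreover have "L / 2 * (norm (x - y))\<^sup>2 \<le> L / 2 * (diameter C)\<^sup>2"
    using diameter_bounded_bound[OF compact_imp_bounded[OF C(1)] xC y] L
    by (intro mult_left_mono power_mono) (auto simp: dist_norm)
  ultimately show "f x - f z \<le> L * (diameter C)\<^sup>2 / 2" by simp
qed

text \<open>The map \<open>h \<mapsto> h - h\<^sup>2 / (2 B)\<close> is increasing up to \<open>B\<close>, so \<open>h\<close> may be replaced by its bound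
  \<open>2 B / (t + 4)\<close>, which is mapped to \<open>2 B (t + 3) / (t + 4)\<^sup>2\<close>. As the bound is at most \<open>B / 2\<close>,
  the minimum is attained by its second argument.\<close>

lemma gap_recurrence:
  fixes h h' B t :: real
  assumes "0 \<le> t" "0 \<le> h" "B > 0" "h \<le> 2 * B / (t + 4)"
    and "h' \<le> h - min (h / 2) (h\<^sup>2 / (2 * B))"
  shows "h' \<le> 2 * B / (t + 5)"
proof -
  define a where "a = 2 * B / (t + 4)"
  have "a \<le> 2 * B / 4"
    unfolding a_def using assms by (intro divide_left_mono) auto
  then have a: "h \<le> a" "a \<le> B / 2" using assms by (auto simp: a_def)
  have "h * h \<le> h * B" using a assms by (intro mult_left_mono) auto
  then have "h\<^sup>2 / (2 * B) \<le> h / 2"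
    using assms(3) by (simp add: field_simps power2_eq_square)
  then have "h' \<le> h - h\<^sup>2 / (2 * B)" using assms(5) by simp
  also have "\<dots> \<le> a - a\<^sup>2 / (2 * B)"
  proof -
    have "0 \<le> (a - h) * (2 * B - a - h)" using a assms(3) by (intro mult_nonneg_nonneg) auto
    then have "h * (2 * B) - h\<^sup>2 \<le> a * (2 * B) - a\<^sup>2" by (simp add: algebra_simps power2_eq_square)
    then have "(h * (2 * B) - h\<^sup>2) / (2 * B) \<le> (a * (2 * B) - a\<^sup>2) / (2 * B)"
      using assms(3) by (intro divide_right_mono) auto
    then show ?thesis using assms(3) by (simp add: diff_divide_distrib)
  qed
  also have "\<dots> = 2 * B * ((t + 3) / (t + 4)\<^sup>2)"
  proof -
    have "a\<^sup>2 / (2 * B) = 2 * B / (t + 4)\<^sup>2"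
      using assms(3) by (simp add: a_def power_divide power_mult_distrib) (simp add: power2_eq_square)
    moreover have "a = 2 * B * (t + 4) / (t + 4)\<^sup>2"
      using assms(1) by (simp add: a_def power2_eq_square)
    ultimately show ?thesis
      by (simp add: algebra_simps flip: diff_divide_distrib)
  qed
  also have "\<dots> \<le> 2 * B * (1 / (t + 5))"
  proof -
    have "(t + 3) * (t + 5) \<le> 1 * (t + 4)\<^sup>2"
      by (simp add: algebra_simps power2_eq_square)
    then have "(t + 3) / (t + 4)\<^sup>2 \<le> 1 / (t + 5)"
      using assms(1) by (simp add: divide_simps)
    then show ?thesis using assms(3) by (intro mult_left_mono) auto
  qed
  finally show ?thesis by simp
qed

theorem theorem3p3:
  fixes f :: "'a::euclidean_space \<Rightarrow> real"
    and C :: "'a set"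
    and L \<mu> \<delta> :: real
    and K T :: nat
    and y :: 'a
    and x :: "nat \<Rightarrow> 'a"
  assumes "C \<noteq> {}" and "compact C" and "convex C"
    and "L_smooth L f" and "convex_on UNIV f" and "gradient_dominated \<mu> f"
    and "y \<in> C" and "K > 0" and "0 < \<delta>" and "\<delta> < 1"
    and "boostfw_run f C L K \<delta> T y x"
  shows "\<forall>t\<le>T. f (x t) - (INF z\<in>C. f z) \<le> 4 * L * (diameter C)\<^sup>2 / (real t + 2)"
proof -
  have L: "L > 0" using assms(4) by (simp add: L_smooth_def)
  define B where "B = L * (diameter C)\<^sup>2"
  have "continuous_on C f"
    using assms(4) by (intro continuous_at_imp_continuous_on)
      (auto simp: L_smooth_def intro: differentiable_imp_continuous_within)
  then obtain z where z: "z \<in> C" "\<And>w. w \<in> C \<Longrightarrow> f z \<le> f w"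
    using continuous_attains_inf[OF assms(2,1)] by blast
  have inf: "(INF w\<in>C. f w) = f z"
    using z by (intro cInf_eq_minimum) auto
  have start: "is_arg_min (\<lambda>v. grad f y \<bullet> v) (\<lambda>v. v \<in> oracle_points C) (x 0)"
    and steps: "\<And>t. t < T \<Longrightarrow> \<not> is_arg_min f (\<lambda>z. z \<in> C) (x t)"
      "\<And>t. t < T \<Longrightarrow> boostfw_step f C L K \<delta> (x t) (x (Suc t))"
    using assms(11) by (auto simp: boostfw_run_def)
  have rate: "x t \<in> C \<and> f (x t) - f z \<le> 2 * B / (real t + 4)" if "t \<le> T" for t
    using that
  proof (induction t)
    case 0
    show ?case
      using initial_gap[OF assms(2-5,7) z(1) start] by (simp add: B_def)
  next
    case (Suc t)
    then have IH: "x t \<in> C" "f (x t) - f z \<le> 2 * B / (real t + 4)" and lt: "t < T" by auto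
    have less: "f z < f (x t)"
      using steps(1)[OF lt] IH(1) z by (force simp: is_arg_min_linorder)
    have "0 < 2 * B / (real t + 4)"
      using IH(2) less by linarith
    then have "B > 0"
      by (auto simp: zero_less_divide_iff)
    note dec = boostfw_step_decrease[OF assms(2-5,8-10) IH(1) z(1) less steps(2)[OF lt]]
    have "f (x (Suc t)) - f z \<le> 2 * B / (5 + real t)"
      unfolding add.commute[of 5] using less IH(2) dec(2) \<open>B > 0\<close>
      by (intro gap_recurrence[of _ "f (x t) - f z"]) (auto simp: B_def mult.assoc)
    with dec(1) show ?case by simp
  qed
  show ?thesis
  proof (intro allI impI)
    fix t assume "t \<le> T"
    have B: "B \<ge> 0" using L by (simp add: B_def)
    have "2 * B / (real t + 4) \<le> 4 * B / (real t + 2)"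
      using B by (intro frac_le) auto
    with rate[OF \<open>t \<le> T\<close>] show "f (x t) - (INF z\<in>C. f z) \<le> 4 * L * (diameter C)\<^sup>2 / (real t + 2)"
      by (simp add: inf B_def mult.assoc)
  qed
qed

end
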